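(* Let $X\in\mathrm{dom}(\mathcal{R})$. Then: 1. $\mathcal{R}(X)\in\mathrm{dom}(\mathcal{R})$. 2. $\widehat{T}^D_X=\overline{T_X}\,T_{\mathcal{R}(X)}$. In particular, the closed-loop matrices $\widehat{T}_X$ and $\widehat{T}^D_X$ coincide for every $X\in\mathcal{R}_{=}$.
   Context: Notation. $M^H$ is the conjugate transpose and $\overline{M}$ the entrywise complex conjugate of a matrix $M$; $I$ is an identity matrix of suitable size; $M\oplus N$ is the block diagonal matrix with blocks $M,N$; $\mathbb{H}_\ell$ is the set of $\ell\times\ell$ complex Hermitian matrices. Data. $A\in\mathbb{C}^{n\times n}$, $B\in\mathbb{C}^{n\times m}$, $R\in\mathbb{H}_m$ nonsingular, $H\in\mathbb{H}_n$, $G:=BR^{-1}B^H$. For $X\in\mathbb{H}_n$ put $R_X:=R+B^H\overline{X}B$ (so $R_H=R+B^H\overline{H}B$), and $\mathrm{dom}(\mathcal{R}):=\{X\in\mathbb{H}_n : \det R_X\neq 0\}$. Standing assumption: $\det R_H\neq0$. For $X\in\mathrm{dom}(\mathcal{R})$ let $$\mathcal{R}(X):=A^H\overline{X}A-A^H\overline{X}B\,R_X^{-1}B^H\overline{X}A+H=A^H\overline{X}(I+G\overline{X})^{-1}A+H,$$ $F_X:=R_X^{-1}B^H\overline{X}A$, $T_X:=A-BF_X=(I+G\overline{X})^{-1}A$, $\widehat{T}_X:=\overline{T_X}\,T_X$, and $\mathcal{R}_{=}:=\{X\in\mathrm{dom}(\mathcal{R}) : X=\mathcal{R}(X)\}$.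 Transformed coefficients: $\widehat{A}:=\overline{A}A-\overline{A}B R_H^{-1}B^H\overline{H}A$, $\widehat{B}:=[\,\overline{B}\ \ \overline{A}B\,]\in\mathbb{C}^{n\times 2m}$, $\widehat{R}:=\overline{R}\oplus R_H$, $\widehat{G}:=\widehat{B}\widehat{R}^{-1}\widehat{B}^H=\overline{G}+\overline{A}(I+G\overline{H})^{-1}G\,\overline{A}^H$, $\widehat{R}_X:=\widehat{R}+\widehat{B}^HX\widehat{B}$, $\widehat{F}_X:=\widehat{R}_X^{-1}\widehat{B}^HX\widehat{A}$, and $$\widehat{T}^D_X:=\widehat{A}-\widehat{B}\widehat{F}_X=(I+\widehat{G}X)^{-1}\widehat{A};$$ this notation is used for $X\in\mathrm{dom}(\mathcal{R})$.
   Formalization: Items 1 and 2 are proved under the added hypothesis that R̂_X is nonsingular; without it item 1 fails (n=m=1, A=B=R=1, H=0, X=-1/2 gives R(X)=-1 and R_{R(X)}=0) and T̂^D_X is undefined. The clause on fixed points X in R_= needs no such hypothesis. *)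

theory Defs
  imports "HOL-Analysis.Analysis"
begin

abbreviation mconj :: "complex^'c^'r \<Rightarrow> complex^'c^'r"
  where "mconj M \<equiv> map_matrix cnj M"

definition mherm :: "complex^'c^'r \<Rightarrow> complex^'r^'c"
  where "mherm M = transpose (mconj M)"

definition hermitian_mats :: "(complex^'l^'l) set"
  where "hermitian_mats = {M. mherm M = M}"

text \<open>The index set of a block matrix is the disjoint sum of the index sets of its blocks, so a
  matrix with \<open>2m\<close> columns has column index type \<open>'m + 'm\<close>.\<close>

definition hcat :: "complex^'p^'n \<Rightarrow> complex^'q^'n \<Rightarrow> complex^('p + 'q)^'n"
  where "hcat M N = (\<chi> i j. case j of Inl a \<Rightarrow> M $ i $ a | Inr b \<Rightarrow> N $ i $ b)"

definition dsum :: "complex^'p^'p \<Rightarrow> complex^'q^'q \<Rightarrow> complex^('p + 'q)^('p + 'q)"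
  where "dsum M N = (\<chi> i j. case (i, j) of
      (Inl a, Inl b) \<Rightarrow> M $ a $ b
    | (Inr a, Inr b) \<Rightarrow> N $ a $ b
    | _ \<Rightarrow> 0)"

definition R_at :: "complex^'m^'n \<Rightarrow> complex^'m^'m \<Rightarrow> complex^'n^'n \<Rightarrow> complex^'m^'m"
  where "R_at B R X = R + mherm B ** mconj X ** B"

definition ric_dom :: "complex^'m^'n \<Rightarrow> complex^'m^'m \<Rightarrow> (complex^'n^'n) set"
  where "ric_dom B R = {X \<in> hermitian_mats. det (R_at B R X) \<noteq> 0}"

definition ric :: "complex^'n^'n \<Rightarrow> complex^'m^'n \<Rightarrow> complex^'m^'m \<Rightarrow> complex^'n^'n
    \<Rightarrow> complex^'n^'n \<Rightarrow> complex^'n^'n"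
  where "ric A B R H X =
    mherm A ** mconj X ** A
      - mherm A ** mconj X ** B ** matrix_inv (R_at B R X) ** mherm B ** mconj X ** A + H"

definition F_at :: "complex^'n^'n \<Rightarrow> complex^'m^'n \<Rightarrow> complex^'m^'m \<Rightarrow> complex^'n^'n
    \<Rightarrow> complex^'n^'m"
  where "F_at A B R X = matrix_inv (R_at B R X) ** mherm B ** mconj X ** A"

definition T_at :: "complex^'n^'n \<Rightarrow> complex^'m^'n \<Rightarrow> complex^'m^'m \<Rightarrow> complex^'n^'n
    \<Rightarrow> complex^'n^'n"
  where "T_at A B R X = A - B ** F_at A B R X"

definition That_at :: "complex^'n^'n \<Rightarrow> complex^'m^'n \<Rightarrow> complex^'m^'m \<Rightarrow> complex^'n^'n
    \<Rightarrow> complex^'n^'n"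
  where "That_at A B R X = mconj (T_at A B R X) ** T_at A B R X"

definition ric_fixed :: "complex^'n^'n \<Rightarrow> complex^'m^'n \<Rightarrow> complex^'m^'m \<Rightarrow> complex^'n^'n
    \<Rightarrow> (complex^'n^'n) set"
  where "ric_fixed A B R H = {X \<in> ric_dom B R. X = ric A B R H X}"

definition A_hat :: "complex^'n^'n \<Rightarrow> complex^'m^'n \<Rightarrow> complex^'m^'m \<Rightarrow> complex^'n^'n
    \<Rightarrow> complex^'n^'n"
  where "A_hat A B R H =
    mconj A ** A - mconj A ** B ** matrix_inv (R_at B R H) ** mherm B ** mconj H ** A"

definition B_hat :: "complex^'n^'n \<Rightarrow> complex^'m^'n \<Rightarrow> complex^('m + 'm)^'n"
  where "B_hat A B = hcat (mconj B) (mconj A ** B)"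

definition R_hat :: "complex^'m^'n \<Rightarrow> complex^'m^'m \<Rightarrow> complex^'n^'n
    \<Rightarrow> complex^('m + 'm)^('m + 'm)"
  where "R_hat B R H = dsum (mconj R) (R_at B R H)"

text \<open>In the transformed equation \<open>X\<close> enters without conjugation.

  \<open>R_hat_at A B R H X\<close> can be singular for \<open>X\<close> in \<open>ric_dom B R\<close>, and then its inverse, and with
  it \<open>T_hat_D\<close>, does not exist. By the Schur complement,
  \<open>det (R_hat_at A B R H X) = cnj (det (R_at B R X)) * det (R_at B R (ric A B R H X))\<close> on
  \<open>ric_dom B R\<close>. Scalar example with \<open>A = B = R = 1\<close>, \<open>H = 0\<close>, \<open>X = - 1 / 2\<close>: here \<open>R_at\<close> is
  \<open>1 / 2\<close> at \<open>X\<close>, but \<open>ric\<close> maps \<open>X\<close> to \<open>- 1\<close>, where \<open>R_at\<close> is \<open>0\<close>. Statements about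
  \<open>T_hat_D\<close> at a general \<open>X\<close> therefore need the nonsingularity of \<open>R_hat_at\<close> as a proviso.\<close>

definition R_hat_at :: "complex^'n^'n \<Rightarrow> complex^'m^'n \<Rightarrow> complex^'m^'m \<Rightarrow> complex^'n^'n
    \<Rightarrow> complex^'n^'n \<Rightarrow> complex^('m + 'm)^('m + 'm)"
  where "R_hat_at A B R H X = R_hat B R H + mherm (B_hat A B) ** X ** B_hat A B"

definition F_hat_at :: "complex^'n^'n \<Rightarrow> complex^'m^'n \<Rightarrow> complex^'m^'m \<Rightarrow> complex^'n^'n
    \<Rightarrow> complex^'n^'n \<Rightarrow> complex^'n^('m + 'm)"
  where "F_hat_at A B R H X =
    matrix_inv (R_hat_at A B R H X) ** mherm (B_hat A B) ** X ** A_hat A B R H"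

definition T_hat_D :: "complex^'n^'n \<Rightarrow> complex^'m^'n \<Rightarrow> complex^'m^'m \<Rightarrow> complex^'n^'n
    \<Rightarrow> complex^'n^'n \<Rightarrow> complex^'n^'n"
  where "T_hat_D A B R H X = A_hat A B R H - B_hat A B ** F_hat_at A B R H X"

end

theory Submission
  imports Defs
begin

text \<open>The block \<open>mconj (R_at B R X)\<close> of \<open>R_hat_at A B R H X\<close> has the Schur complement
  \<open>R_at B R (ric A B R H X)\<close>, so the two matrices \<open>R_hat_at\<close> and \<open>R_at\<close> at \<open>ric\<close> are
  singular together. Block elimination in the linear system that defines \<open>F_hat_at\<close> shows that its
  lower block is the difference of the feedback matrices \<open>F_at\<close> at \<open>ric A B R H X\<close> and at
  \<open>H\<close>; eliminating the upper block produces the left factor \<open>mconj (T_at A B R X)\<close>.\<close>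

section \<open>Distributivity and inverses of square matrices\<close>

lemma matrix_add_rdistrib:
  fixes A :: "'a::semiring_1^'n^'m"
  shows "(A + B) ** C = A ** C + B ** C"
  by (vector matrix_matrix_mult_def sum.distrib distrib_right)

lemma matrix_diff_ldistrib:
  fixes A :: "'a::ring_1^'n^'m"
  shows "A ** (B - C) = A ** B - A ** C"
  by (vector matrix_matrix_mult_def sum_subtractf right_diff_distrib)

lemma matrix_diff_rdistrib:
  fixes A :: "'a::ring_1^'n^'m"
  shows "(A - B) ** C = A ** C - B ** C"
  by (vector matrix_matrix_mult_def sum_subtractf left_diff_distrib)

lemmas mat_distribs = matrix_add_ldistrib matrix_add_rdistrib
  matrix_diff_ldistrib matrix_diff_rdistrib

lemma
  fixes A :: "'a::field^'n^'n"
  assumes "det A \<noteq> 0"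
  shows matrix_inv_mult_right: "A ** matrix_inv A = mat 1"
    and matrix_inv_mult_left: "matrix_inv A ** A = mat 1"
proof -
  have "\<exists>B. A ** B = mat 1 \<and> B ** A = mat 1"
    using assms invertible_det_nz[of A] by (simp add: invertible_def)
  then have "A ** matrix_inv A = mat 1 \<and> matrix_inv A ** A = mat 1"
    unfolding matrix_inv_def by (rule someI_ex)
  then show "A ** matrix_inv A = mat 1" "matrix_inv A ** A = mat 1"
    by auto
qed

lemma matrix_inv_cancel:
  fixes A :: "'a::field^'n^'n"
  assumes "det A \<noteq> 0"
  shows "A ** (matrix_inv A ** C) = C" and "matrix_inv A ** (A ** C) = C"
  by (simp_all add: matrix_mul_assoc matrix_inv_mult_left matrix_inv_mult_right assms)

text \<open>Nonsingularity is always shown below by exhibiting a right inverse, so no determinant of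
  a block matrix has to be expanded.\<close>

lemma right_inverse_det_nonzero:
  fixes A :: "'a::field^'n^'n"
  assumes "A ** B = mat 1"
  shows "det A \<noteq> 0"
  by (metis assms invertible_det_nz invertible_right_inverse)

lemma matrix_inv_eq:
  fixes A :: "'a::field^'n^'n"
  assumes "A ** B = mat 1"
  shows "matrix_inv A = B"
  by (metis assms matrix_inv_cancel(2) matrix_mul_rid right_inverse_det_nonzero)

section \<open>Entrywise conjugation and conjugate transpose\<close>

lemma mconj_mult: "mconj (M ** N) = mconj M ** mconj N"
  by (simp add: vec_eq_iff matrix_matrix_mult_def)

lemma mconj_add: "mconj (M + N) = mconj M + mconj N"
  by (simp add: vec_eq_iff)

lemma mconj_diff: "mconj (M - N) = mconj M - mconj N"
  by (simp add: vec_eq_iff)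

lemma mconj_mconj [simp]: "mconj (mconj M) = M"
  by (simp add: vec_eq_iff)

lemma mconj_mat_1 [simp]: "mconj (mat 1) = mat 1"
  by (simp add: vec_eq_iff mat_def)

lemma mconj_mherm: "mconj (mherm M) = mherm (mconj M)"
  by (simp add: vec_eq_iff mherm_def transpose_def)

lemma mconj_matrix_inv:
  fixes M :: "complex^'n^'n"
  assumes "det M \<noteq> 0"
  shows "det (mconj M) \<noteq> 0" and "matrix_inv (mconj M) = mconj (matrix_inv M)"
proof -
  have *: "mconj M ** mconj (matrix_inv M) = mat 1"
    by (simp add: assms matrix_inv_mult_right flip: mconj_mult)
  show "det (mconj M) \<noteq> 0" "matrix_inv (mconj M) = mconj (matrix_inv M)"
    using right_inverse_det_nonzero[OF *] matrix_inv_eq[OF *] by auto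
qed

lemma mherm_mult: "mherm (M ** N) = mherm N ** mherm M"
  by (simp add: mherm_def mconj_mult matrix_transpose_mul)

lemma mherm_add: "mherm (M + N) = mherm M + mherm N"
  by (simp add: vec_eq_iff mherm_def transpose_def)

lemma mherm_diff: "mherm (M - N) = mherm M - mherm N"
  by (simp add: vec_eq_iff mherm_def transpose_def)

lemma mherm_mherm [simp]: "mherm (mherm M) = M"
  by (simp add: vec_eq_iff mherm_def transpose_def)

lemma mherm_mat_1 [simp]: "mherm (mat 1) = mat 1"
  by (simp add: mherm_def transpose_mat)

text \<open>Applying \<open>mherm\<close> to \<open>matrix_inv M ** M = mat 1\<close> makes
  \<open>mherm (matrix_inv M)\<close> a right inverse of \<open>M\<close>.\<close>

lemma mherm_matrix_inv:
  fixes M :: "complex^'n^'n"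
  assumes "det M \<noteq> 0" and "mherm M = M"
  shows "mherm (matrix_inv M) = matrix_inv M"
proof -
  have "mherm (matrix_inv M ** M) = mat 1"
    using assms by (simp add: matrix_inv_mult_left)
  then show ?thesis
    using assms matrix_inv_eq by (metis mherm_mult)
qed

section \<open>Block matrices and Schur complements\<close>

definition vcat :: "'a^'c^'p \<Rightarrow> 'a^'c^'q \<Rightarrow> 'a^'c^('p + 'q)"
  where "vcat M N = (\<chi> i. case i of Inl a \<Rightarrow> M $ a | Inr b \<Rightarrow> N $ b)"

lemma vcat_cases:
  obtains M N where "Z = vcat M N"
proof
  show "Z = vcat (\<chi> a. Z $ Inl a) (\<chi> b. Z $ Inr b)"
    by (auto simp: vcat_def vec_eq_iff split: sum.split)
qed

lemma vcat_eq_iff: "vcat M N = vcat M' N' \<longleftrightarrow> M = M' \<and> N = N'"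
proof
  assume "vcat M N = vcat M' N'"
  then have "vcat M N $ Inl a = vcat M' N' $ Inl a" "vcat M N $ Inr b = vcat M' N' $ Inr b" for a b
    by auto
  then show "M = M' \<and> N = N'"
    by (auto simp: vcat_def vec_eq_iff)
qed auto

lemma vcat_add: "vcat M N + vcat M' N' = vcat (M + M') (N + N')"
  by (auto simp: vcat_def vec_eq_iff split: sum.split)

lemma hcat_add: "hcat M N + hcat M' N' = hcat (M + M') (N + N')"
  by (auto simp: hcat_def vec_eq_iff split: sum.split)

lemma vcat_mult: "vcat M N ** Z = vcat (M ** Z) (N ** Z)"
  by (auto simp: vcat_def matrix_matrix_mult_def vec_eq_iff split: sum.split)

lemma mult_hcat: "Z ** hcat M N = hcat (Z ** M) (Z ** N)"
  by (auto simp: hcat_def matrix_matrix_mult_def vec_eq_iff split: sum.split)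

lemma hcat_mult_vcat: "hcat M N ** vcat M' N' = M ** M' + N ** N'"
proof -
  \<comment> \<open>The sum over the inner index type splits into the sums over its two
    summands.\<close>
  have "(hcat M N ** vcat M' N') $ i $ j = (M ** M' + N ** N') $ i $ j" for i j
    by (simp add: hcat_def vcat_def matrix_matrix_mult_def UNIV_Plus_UNIV[symmetric]
        sum.Plus del: UNIV_Plus_UNIV)
  then show ?thesis
    by (simp add: vec_eq_iff)
qed

lemma mherm_hcat: "mherm (hcat M N) = vcat (mherm M) (mherm N)"
  by (auto simp: hcat_def vcat_def mherm_def transpose_def vec_eq_iff split: sum.split)

lemma dsum_eq_block: "dsum M N = vcat (hcat M 0) (hcat 0 N)"
  by (auto simp: hcat_def vcat_def dsum_def vec_eq_iff split: sum.split)

lemma hcat_vcat: "hcat (vcat M N) (vcat M' N') = vcat (hcat M M') (hcat N N')"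
  by (auto simp: hcat_def vcat_def vec_eq_iff split: sum.split)

lemma block_mult_vcat:
  "vcat (hcat P Q) (hcat Q' S) ** vcat U V = vcat (P ** U + Q ** V) (Q' ** U + S ** V)"
  by (simp add: vcat_mult hcat_mult_vcat)

text \<open>Block Gaussian elimination with pivot \<open>P\<close>: the first block row determines
  \<open>U\<close>, and substituting it into the second leaves a system for \<open>V\<close> whose
  matrix is the Schur complement.\<close>

lemma block_solve:
  fixes P :: "complex^'p^'p" and S :: "complex^'q^'q"
  assumes "det P \<noteq> 0"
  shows "vcat (hcat P Q) (hcat Q' S) ** vcat U V = vcat C D \<longleftrightarrow>
    U = matrix_inv P ** (C - Q ** V) \<and>
    (S - Q' ** matrix_inv P ** Q) ** V = D - Q' ** matrix_inv P ** C"
proof -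
  have "P ** U + Q ** V = C \<longleftrightarrow> U = matrix_inv P ** (C - Q ** V)"
    using matrix_inv_cancel[OF assms] by (metis add_diff_cancel_right' diff_add_cancel)
  moreover have "Q' ** U + S ** V = D \<longleftrightarrow>
      (S - Q' ** matrix_inv P ** Q) ** V = D - Q' ** matrix_inv P ** C"
    if "U = matrix_inv P ** (C - Q ** V)"
    unfolding that by (auto simp: mat_distribs matrix_mul_assoc algebra_simps)
  ultimately show ?thesis
    by (auto simp: block_mult_vcat vcat_eq_iff)
qed

lemma det_block_nonzero_iff:
  fixes P :: "complex^'p^'p" and S :: "complex^'q^'q"
  assumes "det P \<noteq> 0"
  shows "det (vcat (hcat P Q) (hcat Q' S)) \<noteq> 0 \<longleftrightarrow> det (S - Q' ** matrix_inv P ** Q) \<noteq> 0"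
    (is "det ?M \<noteq> 0 \<longleftrightarrow> det ?N \<noteq> 0")
proof
  assume "det ?M \<noteq> 0"
  \<comment> \<open>The lower block of the last block column of the inverse is a right inverse of
    \<open>?N\<close>.\<close>
  obtain U V where "matrix_inv ?M ** vcat 0 (mat 1 :: complex^'q^'q) = vcat U V"
    by (rule vcat_cases)
  then have "?M ** vcat U V = vcat 0 (mat 1)"
    by (metis \<open>det ?M \<noteq> 0\<close> matrix_inv_cancel(1))
  then have "?N ** V = mat 1"
    by (simp add: block_solve[OF assms])
  then show "det ?N \<noteq> 0"
    by (rule right_inverse_det_nonzero)
next
  assume "det ?N \<noteq> 0"
  obtain C D where CD: "(mat 1 :: complex^('p + 'q)^('p + 'q)) = vcat C D"
    by (rule vcat_cases)
  \<comment> \<open>Solve the reduced system for the right-hand side \<open>mat 1\<close>; back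
    substitution then gives the upper block of a right inverse of \<open>?M\<close>.\<close>
  define V where "V = matrix_inv ?N ** (D - Q' ** matrix_inv P ** C)"
  have "?M ** vcat (matrix_inv P ** (C - Q ** V)) V = mat 1"
    unfolding CD block_solve[OF assms]
    by (simp add: V_def matrix_inv_cancel \<open>det ?N \<noteq> 0\<close>)
  then show "det ?M \<noteq> 0"
    by (rule right_inverse_det_nonzero)
qed

section \<open>The Riccati map and the transformed coefficients\<close>

lemma mherm_R_at:
  assumes "mherm R = R" "mherm X = X"
  shows "mherm (R_at B R X) = R_at B R X"
  using assms
  by (simp add: R_at_def mherm_add mherm_mult matrix_mul_assoc flip: mconj_mherm)

lemma mherm_ric:
  assumes "mherm R = R" "mherm H = H" "mherm X = X" "det (R_at B R X) \<noteq> 0"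
  shows "mherm (ric A B R H X) = ric A B R H X"
  using assms
  by (simp add: ric_def mherm_add mherm_diff mherm_mult mherm_matrix_inv mherm_R_at
      matrix_mul_assoc flip: mconj_mherm)

lemma R_hat_at_block:
  "R_hat_at A B R H X = vcat
     (hcat (mconj (R_at B R X)) (mherm (mconj B) ** X ** mconj A ** B))
     (hcat (mherm B ** mherm (mconj A) ** X ** mconj B)
       (R_at B R H + mherm B ** mherm (mconj A) ** X ** mconj A ** B))"
  by (simp add: R_hat_at_def R_hat_def dsum_eq_block B_hat_def mherm_hcat vcat_mult mult_hcat
      hcat_vcat vcat_add hcat_add mherm_mult matrix_mul_assoc R_at_def[of B R X] mconj_add mconj_mult
      mconj_mherm)

context
  fixes A H X :: "complex^'n^'n" and B :: "complex^'m^'n" and R :: "complex^'m^'m"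
  assumes dX: "det (R_at B R X) \<noteq> 0"
begin

text \<open>\<open>R_at\<close> sees its argument only through the conjugate, and conjugating
  \<open>ric\<close> turns \<open>mconj X\<close> into the plain \<open>X\<close> of the transformed
  coefficients.\<close>

lemma mconj_ric:
  "mconj (ric A B R H X) = mherm (mconj A) ** X ** mconj A
    - mherm (mconj A) ** X ** mconj B ** matrix_inv (mconj (R_at B R X))
      ** mherm (mconj B) ** X ** mconj A + mconj H"
  by (simp add: ric_def mconj_add mconj_diff mconj_mult mconj_mherm mconj_matrix_inv dX)

text \<open>Multiply \<open>mconj_ric\<close> by \<open>mherm B\<close> and \<open>B\<close> on the
  two sides; the term with \<open>mconj H\<close> joins \<open>R\<close> to form
  \<open>R_at B R H\<close>.\<close>

lemma schur_complement_eq_R_at_ric: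
  "R_at B R H + mherm B ** mherm (mconj A) ** X ** mconj A ** B
    - mherm B ** mherm (mconj A) ** X ** mconj B ** matrix_inv (mconj (R_at B R X))
      ** (mherm (mconj B) ** X ** mconj A ** B) = R_at B R (ric A B R H X)"
  by (simp add: R_at_def[of B R H] R_at_def[of B R "ric A B R H X"] mconj_ric mat_distribs
      matrix_mul_assoc)

lemma det_R_hat_at_nonzero_iff:
  "det (R_hat_at A B R H X) \<noteq> 0 \<longleftrightarrow> det (R_at B R (ric A B R H X)) \<noteq> 0"
  by (simp only: R_hat_at_block det_block_nonzero_iff[OF mconj_matrix_inv(1)[OF dX]]
      schur_complement_eq_R_at_ric)

lemma T_hat_D_eq:
  assumes dH: "det (R_at B R H) \<noteq> 0" and dhat: "det (R_hat_at A B R H X) \<noteq> 0"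
  shows "T_hat_D A B R H X = mconj (T_at A B R X) ** T_at A B R (ric A B R H X)"
proof -
  let ?P = "mconj (R_at B R X)" and ?Y = "ric A B R H X" and ?FH = "F_at A B R H"
  define Ac where "Ac = mconj A"
  define Bc where "Bc = mconj B"
  \<comment> \<open>\<open>W\<close> isolates the part of \<open>mconj ?Y\<close> that depends on
    \<open>X\<close>; it measures the passage from \<open>H\<close> to \<open>?Y\<close>.\<close>
  define W where "W = mconj ?Y - mconj H"
  obtain U V where F: "F_hat_at A B R H X = vcat U V"
    by (rule vcat_cases)
  have Ahat: "A_hat A B R H = Ac ** (A - B ** ?FH)"
    by (simp add: A_hat_def F_at_def Ac_def mat_distribs matrix_mul_assoc)
  have W: "W = mherm Ac ** X ** Ac - mherm Ac ** X ** Bc ** matrix_inv ?P ** mherm Bc ** X ** Ac"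
    by (simp add: W_def mconj_ric Ac_def Bc_def)
  have "R_hat_at A B R H X ** F_hat_at A B R H X = mherm (B_hat A B) ** X ** A_hat A B R H"
    unfolding F_hat_at_def by (simp add: matrix_mul_assoc matrix_inv_mult_right dhat)
  also have "\<dots> = vcat (mherm Bc ** X ** A_hat A B R H)
      (mherm B ** mherm Ac ** X ** A_hat A B R H)"
    by (simp add: B_hat_def mherm_hcat vcat_mult mherm_mult Ac_def Bc_def matrix_mul_assoc)
  finally have
    U: "U = matrix_inv ?P ** (mherm Bc ** X ** A_hat A B R H - mherm Bc ** X ** Ac ** B ** V)"
    and V: "R_at B R ?Y ** V = mherm B ** mherm Ac ** X ** A_hat A B R H
      - mherm B ** mherm Ac ** X ** Bc ** matrix_inv ?P ** (mherm Bc ** X ** A_hat A B R H)"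
    unfolding F R_hat_at_block block_solve[OF mconj_matrix_inv(1)[OF dX]]
      schur_complement_eq_R_at_ric Ac_def Bc_def by auto
  \<comment> \<open>Both terms of \<open>V\<close> end in \<open>A - B ** ?FH\<close>, and what
    remains on the left is \<open>mherm B ** W\<close>.\<close>
  have "R_at B R ?Y ** V = mherm B ** W ** (A - B ** ?FH)"
    unfolding V Ahat W by (simp add: mat_distribs matrix_mul_assoc)
  moreover have "R_at B R ?Y = R_at B R H + mherm B ** W ** B"
    by (simp add: R_at_def W_def mat_distribs)
  moreover have "R_at B R H ** ?FH = mherm B ** mconj H ** A"
    by (simp add: F_at_def matrix_mul_assoc matrix_inv_mult_right dH)
  \<comment> \<open>The terms \<open>mherm B ** W ** B ** ?FH\<close> cancel and
    \<open>W + mconj H\<close> is \<open>mconj ?Y\<close>, which leaves the linear equation for the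
    feedback matrix at \<open>?Y\<close>.\<close>
  ultimately have "R_at B R ?Y ** (?FH + V) = mherm B ** mconj ?Y ** A"
    by (simp add: mat_distribs matrix_mul_assoc W_def)
  then have FY: "?FH + V = F_at A B R ?Y"
    using matrix_inv_cancel(2) dhat[unfolded det_R_hat_at_nonzero_iff]
    by (metis F_at_def matrix_mul_assoc)
  have "T_hat_D A B R H X = A_hat A B R H - (Bc ** U + Ac ** B ** V)"
    by (simp add: T_hat_D_def F B_hat_def hcat_mult_vcat Ac_def Bc_def)
  \<comment> \<open>By \<open>Ahat\<close>, subtracting \<open>Ac ** B ** V\<close> from
    \<open>A_hat A B R H\<close> gives \<open>Ac ** (A - B ** (?FH + V))\<close>. The same product
    occurs in \<open>U\<close>, so it factors out on the right.\<close>
  also have "\<dots> = (Ac - Bc ** matrix_inv ?P ** mherm Bc ** X ** Ac) ** (A - B ** (?FH + V))"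
    unfolding U Ahat by (simp add: mat_distribs matrix_mul_assoc algebra_simps)
  also have "Ac - Bc ** matrix_inv ?P ** mherm Bc ** X ** Ac = mconj (T_at A B R X)"
    by (simp add: T_at_def F_at_def mconj_diff mconj_mult mconj_mherm mconj_matrix_inv dX
        Ac_def Bc_def matrix_mul_assoc)
  finally show ?thesis
    by (simp add: FY T_at_def)
qed

end

theorem theorem3p2:
  fixes A H :: "complex^'n^'n" and B :: "complex^'m^'n" and R :: "complex^'m^'m"
  assumes "R \<in> hermitian_mats" and "det R \<noteq> 0"
    and "H \<in> hermitian_mats"
    and "det (R_at B R H) \<noteq> 0"
  shows "(\<forall>X \<in> ric_dom B R. det (R_hat_at A B R H X) \<noteq> 0 \<longrightarrow>
            ric A B R H X \<in> ric_dom B R \<and>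
            T_hat_D A B R H X = mconj (T_at A B R X) ** T_at A B R (ric A B R H X)) \<and>
         (\<forall>X \<in> ric_fixed A B R H. That_at A B R X = T_hat_D A B R H X)"
proof (intro conjI ballI impI)
  fix X assume X: "X \<in> ric_dom B R" and dhat: "det (R_hat_at A B R H X) \<noteq> 0"
  then have dX: "det (R_at B R X) \<noteq> 0"
    by (simp add: ric_dom_def)
  show "ric A B R H X \<in> ric_dom B R"
    using X assms(1,3) dhat dX
    by (simp add: ric_dom_def hermitian_mats_def mherm_ric det_R_hat_at_nonzero_iff)
  show "T_hat_D A B R H X = mconj (T_at A B R X) ** T_at A B R (ric A B R H X)"
    using T_hat_D_eq[OF dX assms(4) dhat] .
next
  fix X assume "X \<in> ric_fixed A B R H"
  then have dX: "det (R_at B R X) \<noteq> 0" and Y: "ric A B R H X = X"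
    by (auto simp: ric_fixed_def ric_dom_def)
  \<comment> \<open>At a fixed point the Schur complement is \<open>R_at B R X\<close> itself, so
    the proviso holds automatically.\<close>
  then have "det (R_hat_at A B R H X) \<noteq> 0"
    by (simp add: det_R_hat_at_nonzero_iff)
  from T_hat_D_eq[OF dX assms(4) this] show "That_at A B R X = T_hat_D A B R H X"
    by (simp add: That_at_def Y)
qed

end
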